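(* Let $p$ be a prime number, let $k\ge 2$ and $n>m\ge 1$ be integers, and let $\epsilon_1,\epsilon_2\in\{-1,+1\}$. Then every complex root $z$ of $f(x)=x^n+\epsilon_1x^m+\epsilon_2p^k$ satisfies $|z|>1$. *)

theory Defs
  imports Complex_Main "HOL-Computational_Algebra.Polynomial" "HOL-Computational_Algebra.Primes"
begin

definition trinomial :: "nat \<Rightarrow> nat \<Rightarrow> nat \<Rightarrow> nat \<Rightarrow> int \<Rightarrow> int \<Rightarrow> int poly" where
  "trinomial p k n m \<epsilon>\<^sub>1 \<epsilon>\<^sub>2 = monom 1 n + monom \<epsilon>\<^sub>1 m + [:\<epsilon>\<^sub>2 * int p ^ k:]"

end

theory Submission
  imports Defs
begin

text \<open>The constant term dominates outside a disc larger than the unit disc's reach: if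
  \<open>cmod z\<close> were at most 1, the two powers of \<open>z\<close> would contribute at most
  1 each in modulus, too little to cancel a constant of modulus \<open>p ^ k\<close>, which is at
  least 4. The lemma \<open>poly_of_int_trinomial\<close> supplies the explicit equation to which
  the triangle inequality is applied.\<close>

lemma poly_of_int_trinomial:
  fixes z :: "'a :: comm_ring_1"
  shows "poly (map_poly of_int (trinomial p k n m \<epsilon>\<^sub>1 \<epsilon>\<^sub>2)) z =
    z ^ n + of_int \<epsilon>\<^sub>1 * z ^ m + of_int \<epsilon>\<^sub>2 * of_nat p ^ k"
proof -
  have "map_poly of_int (trinomial p k n m \<epsilon>\<^sub>1 \<epsilon>\<^sub>2) =
      monom 1 n + monom (of_int \<epsilon>\<^sub>1) m + [:of_int \<epsilon>\<^sub>2 * of_nat p ^ k :: 'a:]"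
    \<comment> \<open>Coefficients are compared: \<open>coeff_map_poly\<close> needs only that
      \<open>of_int\<close> fixes 0, and the case split on the index isolates the constant
      coefficient.\<close>
    by (rule poly_eqI)
      (simp add: trinomial_def coeff_map_poly coeff_pCons split: nat.split)
  then show ?thesis
    by (simp add: poly_monom)
qed

theorem theorem9:
  fixes p k n m :: nat and \<epsilon>\<^sub>1 \<epsilon>\<^sub>2 :: int and z :: complex
  assumes "prime p" and "k \<ge> 2" and "n > m" and "m \<ge> 1"
    and "\<epsilon>\<^sub>1 \<in> {-1, 1}" and "\<epsilon>\<^sub>2 \<in> {-1, 1}"
    and "poly (map_poly of_int (trinomial p k n m \<epsilon>\<^sub>1 \<epsilon>\<^sub>2)) z = 0"
  shows "cmod z > 1"
proof (rule ccontr)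
  assume "\<not> cmod z > 1"
  then have pow_le: "cmod z ^ j \<le> 1" for j
    by (simp add: power_le_one)
  \<comment> \<open>Start of a chain from 4 up to \<open>p ^ k\<close>, then through the root
    equation down to the bound 2.\<close>
  have "(2::real) ^ 2 \<le> 2 ^ k"
    using \<open>k \<ge> 2\<close> by (intro power_increasing) auto
  also have "\<dots> \<le> real p ^ k"
    using prime_ge_2_nat[OF \<open>prime p\<close>] by (intro power_mono) auto
  also have "\<dots> = cmod (of_int \<epsilon>\<^sub>2 * of_nat p ^ k)"
    using assms(6) by (auto simp: norm_mult norm_power)
  \<comment> \<open>The root equation solved for the constant term; the calculation substitutes it
    inside \<open>cmod\<close>.\<close>
  also have "of_int \<epsilon>\<^sub>2 * of_nat p ^ k = - (z ^ n + of_int \<epsilon>\<^sub>1 * z ^ m)"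
    using assms(7) unfolding poly_of_int_trinomial by (simp only: eq_neg_iff_add_eq_0 add.commute)
  also have "cmod \<dots> \<le> cmod (z ^ n) + cmod (of_int \<epsilon>\<^sub>1 * z ^ m)"
    unfolding norm_minus_cancel by (rule norm_triangle_ineq)
  also have "\<dots> = cmod z ^ n + cmod z ^ m"
    using assms(5) by (auto simp: norm_mult norm_power)
  also have "\<dots> \<le> 2"
    using pow_le[of n] pow_le[of m] by simp
  finally show False
    by simp
qed

end
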